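(* Let $0<\epsilon'<\epsilon<\frac12$. Then for all positive integers $N,k$, $$R^{\mathrm{xor}}_{\epsilon'}\left(\mathrm{GapMaj}^\oplus[N,k,\epsilon]\right)\le O\left(N+\log\tfrac1{\epsilon'}\right),$$ with an absolute constant in the $O(\cdot)$ (in particular independent of $k$).
   Context: Gap Majority composed with XOR, $\mathrm{GapMaj}^\oplus[N,k,\epsilon]$: Alice receives $(X_1,\dots,X_N)$ and Bob $(Y_1,\dots,Y_N)$ with $X_i,Y_i\in\{0,1\}^k$, under the promise that there exists $z\in\{0,1\}^k$ with $|\{i\in[N]:X_i\oplus Y_i=z\}|\ge(1-\epsilon)N$ ($\oplus$ bitwise XOR); the required output is $z$. Two-party communication with private randomness $r_A,r_B$ and public randomness $r$; transcript $t_\pi$ = exchanged bits (public randomness excluded); cost = maximum number of bits exchanged. A protocol XOR-computes the problem with error $\epsilon'$ if there are maps $O_A(t_\pi,r,r_A,X)$, $O_B(t_\pi,r,r_B,Y)\in\{0,1\}^k$ such that for every input satisfying the promise, $\Pr[O_A\oplus O_B=z]\ge1-\epsilon'$. $R^{\mathrm{xor}}_{\epsilon'}$ is the minimum cost of such a protocol. *)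

theory Defs
  imports "HOL-Probability.Probability_Mass_Function"
begin

type_synonym bits = "bool list"

definition bitstrings :: "nat \<Rightarrow> bits set" where
  "bitstrings k = {x. length x = k}"

text \<open>Only meaningful for arguments of equal length (the longer one would be truncated).\<close>

definition xor_bits :: "bits \<Rightarrow> bits \<Rightarrow> bits" (infixl "\<oplus>\<^sub>b" 65) where
  "x \<oplus>\<^sub>b y = map2 (\<lambda>a b. a \<noteq> b) x y"

text \<open>At an inner node the named party sends the bit computed from what it sees; the protocol
  goes on in the first subtree if that bit is \<^const>\<open>False\<close>, in the second if it is \<^const>\<open>True\<close>.\<close>

datatype ('a, 'b) prot_tree =
    Halt
  | Alice "'a \<Rightarrow> bool" "('a, 'b) prot_tree" "('a, 'b) prot_tree"
  | Bob "'b \<Rightarrow> bool" "('a, 'b) prot_tree" "('a, 'b) prot_tree"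

primrec run :: "('a, 'b) prot_tree \<Rightarrow> 'a \<Rightarrow> 'b \<Rightarrow> bits" where
  "run Halt a b = []"
| "run (Alice f t0 t1) a b = f a # (if f a then run t1 a b else run t0 a b)"
| "run (Bob g t0 t1) a b = g b # (if g b then run t1 a b else run t0 a b)"

text \<open>The three random strings are independent, each with an arbitrary distribution on finite bit
  strings. As usual for public coins, the whole protocol tree may depend on the public string;
  the message functions in the tree see the party's input and its private string.\<close>

record ('x, 'y) protocol =
  public_coins :: "bits pmf"
  alice_coins :: "bits pmf"
  bob_coins :: "bits pmf"
  tree :: "bits \<Rightarrow> ('x \<times> bits, 'y \<times> bits) prot_tree"

definition transcript :: "('x, 'y) protocol \<Rightarrow> bits \<Rightarrow> bits \<Rightarrow> bits \<Rightarrow> 'x \<Rightarrow> 'y \<Rightarrow> bits" where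
  "transcript \<pi> r rA rB x y = run (tree \<pi> r) (x, rA) (y, rB)"

definition coins :: "('x, 'y) protocol \<Rightarrow> (bits \<times> bits \<times> bits) pmf" where
  "coins \<pi> = pair_pmf (public_coins \<pi>) (pair_pmf (alice_coins \<pi>) (bob_coins \<pi>))"

text \<open>A promise problem whose answer is a bit string of length \<open>out_len\<close>: \<open>answer P x y z\<close> says
  that \<open>(x, y)\<close> satisfies the promise and that \<open>z\<close> is the required output.\<close>

record ('x, 'y) problem =
  alice_inputs :: "'x set"
  bob_inputs :: "'y set"
  out_len :: nat
  answer :: "'x \<Rightarrow> 'y \<Rightarrow> bits \<Rightarrow> bool"

text \<open>The number of bits is maximised over all inputs, also those violating the promise, and over
  all outcomes of the coins. The supremum is infinite if the number of bits is unbounded.\<close>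

definition cost :: "('x, 'y) problem \<Rightarrow> ('x, 'y) protocol \<Rightarrow> enat" where
  "cost P \<pi> = (SUP x\<in>alice_inputs P. SUP y\<in>bob_inputs P. SUP (r, rA, rB)\<in>set_pmf (coins \<pi>).
     enat (length (transcript \<pi> r rA rB x y)))"

definition xor_computes :: "('x, 'y) protocol \<Rightarrow> ('x, 'y) problem \<Rightarrow> real \<Rightarrow> bool" where
  "xor_computes \<pi> P err \<longleftrightarrow>
     (\<exists>(OA :: bits \<Rightarrow> bits \<Rightarrow> bits \<Rightarrow> 'x \<Rightarrow> bits) (OB :: bits \<Rightarrow> bits \<Rightarrow> bits \<Rightarrow> 'y \<Rightarrow> bits).
        (\<forall>t r rA x. OA t r rA x \<in> bitstrings (out_len P)) \<and>
        (\<forall>t r rB y. OB t r rB y \<in> bitstrings (out_len P)) \<and>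
        (\<forall>x\<in>alice_inputs P. \<forall>y\<in>bob_inputs P. \<forall>z. answer P x y z \<longrightarrow>
           measure_pmf.prob (coins \<pi>)
             {(r, rA, rB). OA (transcript \<pi> r rA rB x y) r rA x
                             \<oplus>\<^sub>b OB (transcript \<pi> r rA rB x y) r rB y = z}
           \<ge> 1 - err))"

text \<open>An infimum in \<^typ>\<open>enat\<close> over a nonempty set is attained; it is infinite if no protocol
  XOR-computes the problem.\<close>

definition R_xor :: "real \<Rightarrow> ('x, 'y) problem \<Rightarrow> enat" where
  "R_xor err P = (INF \<pi>\<in>{\<pi>. xor_computes \<pi> P err}. cost P \<pi>)"

definition GapMaj_xor :: "nat \<Rightarrow> nat \<Rightarrow> real \<Rightarrow> (bits list, bits list) problem" where
  "GapMaj_xor N k \<epsilon> =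
     \<lparr> alice_inputs = {X. length X = N \<and> set X \<subseteq> bitstrings k},
       bob_inputs = {Y. length Y = N \<and> set Y \<subseteq> bitstrings k},
       out_len = k,
       answer = (\<lambda>X Y z. z \<in> bitstrings k \<and>
         real (card {i. i < N \<and> X ! i \<oplus>\<^sub>b Y ! i = z}) \<ge> (1 - \<epsilon>) * real N) \<rparr>"

end

theory Submission imports Defs "HOL-Probability.Product_PMF" begin

text \<open>Let \<open>Z i = X i \<oplus> Y i\<close>. The parties elect an index \<open>i\<close> with \<open>Z i = z\<close> and output \<open>X i\<close> and \<open>Y i\<close>,
  so the cost does not involve \<open>k\<close>. Since \<open>Z i = Z j\<close> says that \<open>X i \<oplus> X j = Y i \<oplus> Y j\<close>, the
  Boyer--Moore majority vote needs \<open>N\<close> equality tests between a string of Alice and one of Bob.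

  Testing each of them reliably would be too expensive. Instead, the parties walk on the tree of
  possible histories of answers. Every step uses a constant number of random inner products: one
  test checks all positive answers given so far at once, by comparing the concatenated strings
  (negative answers are never wrong). If it fails, the last answer is retracted; otherwise the next
  query is tested. A correct history is extended correctly, and an incorrect one shortened, with
  probability at least \<open>3/4\<close>; hence \<open>2 ^ length / 4 ^ (length of the correct part)\<close> shrinks by the
  factor \<open>7/8\<close> in expectation, and \<open>O(N + log (1/\<epsilon>'))\<close> steps suffice.\<close>

section \<open>Equality tests by random inner products over the two-element field\<close>

fun parity_hash :: "bits \<Rightarrow> bits \<Rightarrow> bool" where
  "parity_hash (r # rs) (u # us) = ((r \<and> u) \<noteq> parity_hash rs us)"
| "parity_hash _ _ = False"

text \<open>Two independent parities bring the collision probability down to 1/4. One would not do: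
  the expected factor 1/2 * 1/2 + 1/2 * 2 exceeds 1, whereas 3/4 * 1/2 + 1/4 * 2 = 7/8.\<close>

definition hashes_agree :: "bits \<times> bits \<Rightarrow> bits \<Rightarrow> bits \<Rightarrow> bool" where
  "hashes_agree \<rho> u v \<longleftrightarrow>
     parity_hash (fst \<rho>) u = parity_hash (fst \<rho>) v \<and> parity_hash (snd \<rho>) u = parity_hash (snd \<rho>) v"

lemma hashes_agree_refl: "hashes_agree \<rho> u u"
  by (simp add: hashes_agree_def)

definition random_bits :: "nat \<Rightarrow> bits pmf" where
  "random_bits m = replicate_pmf m (bernoulli_pmf (1/2))"

lemma prob_random_bits_Suc:
  "measure_pmf.prob (random_bits (Suc n)) E =
     (measure_pmf.prob (random_bits n) (((#) True) -` E)
       + measure_pmf.prob (random_bits n) (((#) False) -` E)) / 2"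
    (is "_ = ?p")
proof -
  have rec: "random_bits (Suc n) = bernoulli_pmf (1/2) \<bind> (\<lambda>c. map_pmf ((#) c) (random_bits n))"
    by (simp add: random_bits_def map_pmf_def)
  have "ennreal (measure_pmf.prob (random_bits (Suc n)) E) = emeasure (random_bits (Suc n)) E"
    by (simp add: measure_pmf.emeasure_eq_measure)
  also have "\<dots> = ennreal ?p"
    unfolding rec emeasure_bind_pmf
    by (simp add: measure_pmf.emeasure_eq_measure add_divide_distrib ennreal_plus
        divide_ennreal_def[symmetric] flip: divide_ennreal)
  finally show ?thesis
    by (subst (asm) ennreal_inj) auto
qed

text \<open>If the tails agree, the first seed bit alone decides. Otherwise either value of it keeps
  or complements an event that has probability 1/2 by induction.\<close>

lemma prob_parity_hash_collision:
  assumes "length u = length v" "length u \<le> m" "u \<noteq> v"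
  shows "measure_pmf.prob (random_bits m) {r. parity_hash r u = parity_hash r v} = 1/2"
  using assms
proof (induction u v arbitrary: m rule: list_induct2)
  case Nil
  then show ?case by simp
next
  case (Cons a u b v)
  then obtain n where m: "m = Suc n" "length u \<le> n" by (cases m) auto
  let ?E = "{r. parity_hash r (a # u) = parity_hash r (b # v)}"
  show ?case
  proof (cases "u = v")
    case True
    then have E: "((#) True) -` ?E = {}" "((#) False) -` ?E = UNIV"
      using Cons.prems by auto
    show ?thesis unfolding m prob_random_bits_Suc E by simp
  next
    case False
    let ?F = "{r. parity_hash r u = parity_hash r v}"
    have IH: "measure_pmf.prob (random_bits n) ?F = 1/2"
      using Cons.IH m False by simp
    then have IH': "measure_pmf.prob (random_bits n) (- ?F) = 1/2"
      using measure_pmf.prob_compl[of ?F "random_bits n"] by (simp add: Compl_eq_Diff_UNIV)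
    have E: "((#) True) -` ?E = (if a = b then ?F else - ?F)" "((#) False) -` ?E = ?F"
      by auto
    show ?thesis unfolding m prob_random_bits_Suc E using IH IH' by simp
  qed
qed

definition random_seed :: "nat \<Rightarrow> (bits \<times> bits) pmf" where
  "random_seed m = pair_pmf (random_bits m) (random_bits m)"

lemma prob_hashes_agree:
  assumes "length u = length v" "length u \<le> m" "u \<noteq> v"
  shows "measure_pmf.prob (random_seed m) {\<rho>. hashes_agree \<rho> u v} = 1/4"
proof -
  let ?F = "{r. parity_hash r u = parity_hash r v}"
  have "{\<rho>. hashes_agree \<rho> u v} = ?F \<times> ?F"
    by (auto simp: hashes_agree_def)
  then show ?thesis
    unfolding random_seed_def
    by (simp only: measure_pmf_prob_product countableI_type prob_parity_hash_collision[OF assms])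
qed

section \<open>Majority vote\<close>

text \<open>Histories list the answers to the queries with the most recent one first. The vote is that of
  Boyer and Moore: the pair is the current candidate and its lead. Querying an index against itself
  when the lead is 0 makes the number of queries independent of the answers; from length \<open>N\<close> on, the
  vote is frozen and the queries are trivial.\<close>

fun vote :: "nat \<Rightarrow> bool list \<Rightarrow> nat \<times> nat" where
  "vote N [] = (0, 0)"
| "vote N (a # as) =
     (if length as < N then
        if snd (vote N as) = 0 then (length as, 1)
        else (fst (vote N as), if a then snd (vote N as) + 1 else snd (vote N as) - 1)
      else vote N as)"

definition query :: "nat \<Rightarrow> bool list \<Rightarrow> nat \<times> nat" where
  "query N as =
     (if length as < N then (if snd (vote N as) = 0 then length as else fst (vote N as), length as)
      else (0, 0))"

definition true_answer :: "nat \<Rightarrow> (nat \<Rightarrow> 'v) \<Rightarrow> bool list \<Rightarrow> bool" where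
  "true_answer N Z as \<longleftrightarrow> Z (fst (query N as)) = Z (snd (query N as))"

text \<open>The number of answers preceding the first wrong one.\<close>

fun correct_len :: "nat \<Rightarrow> (nat \<Rightarrow> 'v) \<Rightarrow> bool list \<Rightarrow> nat" where
  "correct_len N Z [] = 0"
| "correct_len N Z (a # as) =
     (if correct_len N Z as = length as \<and> a = true_answer N Z as then Suc (length as)
      else correct_len N Z as)"

lemma fst_vote_less: "0 < N \<Longrightarrow> fst (vote N as) < N"
  by (induction as) auto

lemma query_less: "0 < N \<Longrightarrow> fst (query N as) < N \<and> snd (query N as) < N"
  by (auto simp: query_def fst_vote_less)

lemma correct_len_le: "correct_len N Z as \<le> length as"
  by (induction as) auto

text \<open>The indices processed split into \<open>n\<close> with value \<open>Z c\<close> and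
  pairs with distinct values. A value \<open>v\<close> occurs at most once in each pair, which gives
  the bound.\<close>

lemma vote_invariant:
  assumes "min N (length as) \<le> correct_len N Z as"
  defines "c \<equiv> fst (vote N as)" and "n \<equiv> snd (vote N as)"
  shows "2 * card {i. i < min N (length as) \<and> Z i = v} + (if Z c = v then 0 else n)
    \<le> min N (length as) + (if Z c = v then n else 0)"
  using assms(1) unfolding c_def n_def
proof (induction as)
  case Nil
  then show ?case by simp
next
  case (Cons a as)
  have le: "correct_len N Z as \<le> length as" by (rule correct_len_le)
  show ?case
  proof (cases "length as < N")
    case False
    then show ?thesis
      using Cons le by (auto simp: min_def split: if_splits)
  next
    case True
    have corr: "correct_len N Z as = length as" and a: "a = true_answer N Z as"
      using Cons.prems True le by (auto split: if_splits)
    have IH: "2 * card {i. i < length as \<and> Z i = v} + (if Z (fst (vote N as)) = v then 0 else snd (vote N as))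
      \<le> length as + (if Z (fst (vote N as)) = v then snd (vote N as) else 0)"
      using Cons.IH corr True by simp
    have set_eq: "{i. i < Suc (length as) \<and> Z i = v} =
        (if Z (length as) = v then insert (length as) {i. i < length as \<and> Z i = v}
         else {i. i < length as \<and> Z i = v})"
      by (auto simp: less_Suc_eq)
    have "card {i. i < Suc (length as) \<and> Z i = v} =
        card {i. i < length as \<and> Z i = v} + (if Z (length as) = v then 1 else 0)"
      unfolding set_eq by simp
    moreover have "min N (length (a # as)) = Suc (length as)"
      using True by simp
    ultimately show ?thesis
      using IH True a by (auto simp: true_answer_def query_def split: if_splits)
  qed
qed

lemma vote_finds_majority:
  assumes "N \<le> correct_len N Z as" "N < 2 * card {i. i < N \<and> Z i = v}"
  shows "Z (fst (vote N as)) = v"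
proof -
  have "N \<le> length as"
    using assms(1) correct_len_le[of N Z as] by simp
  then show ?thesis
    using vote_invariant[of N as Z v] assms by (auto simp: min_def split: if_splits)
qed

section \<open>The walk on histories\<close>

definition query_diff :: "nat \<Rightarrow> bits list \<Rightarrow> bool list \<Rightarrow> bits" where
  "query_diff N X as = X ! fst (query N as) \<oplus>\<^sub>b X ! snd (query N as)"

text \<open>The block lengths depend only on the history, so the strings of the two parties are
  aligned.\<close>

fun claimed_diffs :: "nat \<Rightarrow> bits list \<Rightarrow> bool list \<Rightarrow> bits" where
  "claimed_diffs N X [] = []"
| "claimed_diffs N X (a # as) = (if a then query_diff N X as else []) @ claimed_diffs N X as"

definition walk_step :: "nat \<Rightarrow> bits list \<Rightarrow> bits list \<Rightarrow> bits \<times> bits \<Rightarrow> bool list \<Rightarrow> bool list" where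
  "walk_step N X Y \<rho> as =
     (if hashes_agree \<rho> (claimed_diffs N X as) (claimed_diffs N Y as)
      then hashes_agree \<rho> (query_diff N X as) (query_diff N Y as) # as
      else tl as)"

lemma xor_bits_swap:
  assumes "length x = k" "length x' = k" "length y = k" "length y' = k"
  shows "x \<oplus>\<^sub>b x' = y \<oplus>\<^sub>b y' \<longleftrightarrow> x \<oplus>\<^sub>b y = x' \<oplus>\<^sub>b y'"
  using assms by (auto simp: xor_bits_def list_eq_iff_nth_eq)

text \<open>Hashing never separates equal strings, so a negative answer is always right.\<close>

fun sound :: "nat \<Rightarrow> (nat \<Rightarrow> 'v) \<Rightarrow> bool list \<Rightarrow> bool" where
  "sound N Z [] \<longleftrightarrow> True"
| "sound N Z (a # as) \<longleftrightarrow> sound N Z as \<and> (true_answer N Z as \<longrightarrow> a)"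

text \<open>Answers before the first wrong one count 1/2 each, all others 2. Correctly extending a
  correct history and retracting from an incorrect one both halve the weight.\<close>

definition history_weight :: "nat \<Rightarrow> (nat \<Rightarrow> 'v) \<Rightarrow> bool list \<Rightarrow> real" where
  "history_weight N Z as = 2 ^ length as / 4 ^ correct_len N Z as"

lemma history_weight_pos: "0 < history_weight N Z as"
  by (simp add: history_weight_def)

text \<open>The Markov bound: a walk that ends in failure has weight at least
  \<open>2 ^ -N\<close>.\<close>

lemma history_weight_ge:
  assumes "correct_len N Z as < N"
  shows "1 \<le> 2 ^ N * history_weight N Z as"
proof -
  have "(4::real) ^ correct_len N Z as = 2 ^ correct_len N Z as * 2 ^ correct_len N Z as"
    by (simp flip: power_mult_distrib)
  also have "\<dots> \<le> 2 ^ N * 2 ^ length as"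
    using assms correct_len_le[of N Z as] by (intro mult_mono power_increasing) auto
  finally show ?thesis
    by (simp add: history_weight_def field_simps)
qed

lemma history_weight_Cons_le: "history_weight N Z (a # as) \<le> 2 * history_weight N Z as"
  using correct_len_le[of N Z as] by (auto simp: history_weight_def field_simps)

lemma history_weight_Cons_correct:
  assumes "correct_len N Z as = length as" "a = true_answer N Z as"
  shows "history_weight N Z (a # as) = history_weight N Z as / 2"
  using assms by (simp add: history_weight_def)

lemma history_weight_tl:
  assumes "correct_len N Z as \<noteq> length as"
  shows "history_weight N Z (tl as) = history_weight N Z as / 2"
  using assms by (cases as) (auto simp: history_weight_def split: if_splits)

locale gap_maj_inputs =
  fixes N k :: nat and X Y :: "bits list"
  assumes N_pos: "0 < N"
    and len_X: "length X = N" and len_Y: "length Y = N"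
    and X_bits: "set X \<subseteq> bitstrings k" and Y_bits: "set Y \<subseteq> bitstrings k"
begin

abbreviation Z :: "nat \<Rightarrow> bits" where
  "Z i \<equiv> X ! i \<oplus>\<^sub>b Y ! i"

lemma length_nth: "i < N \<Longrightarrow> length (X ! i) = k" "i < N \<Longrightarrow> length (Y ! i) = k"
  using subsetD[OF X_bits nth_mem] subsetD[OF Y_bits nth_mem]
  by (simp_all add: len_X len_Y bitstrings_def)

lemma length_query_diff: "length (query_diff N X as) = k" "length (query_diff N Y as) = k"
  using query_less[OF N_pos, of as] by (auto simp: query_diff_def xor_bits_def length_nth)

lemma query_diff_eq_iff: "query_diff N X as = query_diff N Y as \<longleftrightarrow> true_answer N Z as"
  unfolding query_diff_def true_answer_def
  using query_less[OF N_pos, of as] by (intro xor_bits_swap[of _ k]) (simp_all add: length_nth)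

lemma length_claimed_diffs:
  "length (claimed_diffs N X as) = length (claimed_diffs N Y as)"
  "length (claimed_diffs N X as) \<le> length as * k"
  by (induction as) (auto simp: length_query_diff)

text \<open>In a sound history every wrong answer is a false positive, and the block of a false
  positive differs between the parties.\<close>

lemma claimed_diffs_eq_iff:
  "sound N Z as \<Longrightarrow> claimed_diffs N X as = claimed_diffs N Y as \<longleftrightarrow> correct_len N Z as = length as"
proof (induction as)
  case (Cons a as)
  then show ?case
    using correct_len_le[of N Z as]
    by (auto simp: query_diff_eq_iff length_query_diff append_eq_append_conv)
qed simp

lemma sound_walk_step:
  assumes "sound N Z as"
  shows "sound N Z (walk_step N X Y \<rho> as)"
proof -
  note assms
  moreover from this have "sound N Z (tl as)"
    by (cases as) auto
  ultimately show ?thesis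
    by (simp add: walk_step_def hashes_agree_refl flip: query_diff_eq_iff)
qed

lemma expected_weight_walk_step:
  assumes "sound N Z as" "Suc (length as) * k \<le> m"
  shows "(\<integral>\<^sup>+\<rho>. ennreal (history_weight N Z (walk_step N X Y \<rho> as)) \<partial>random_seed m)
    \<le> ennreal (7/8 * history_weight N Z as)"
proof -
  let ?w = "history_weight N Z as"
  \<comment> \<open>Only one test can err. For a correct history the first test passes surely and
    the query test matters; for an incorrect one, failure of the first test suffices. Hence both may
    share the seed.\<close>
  define u where "u = (if correct_len N Z as = length as then query_diff N X as else claimed_diffs N X as)"
  define v where "v = (if correct_len N Z as = length as then query_diff N Y as else claimed_diffs N Y as)"
  define B where "B = {\<rho>. u \<noteq> v \<and> hashes_agree \<rho> u v}"
  have len: "length u = length v" "length u \<le> m"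
    using assms(2) length_claimed_diffs[of as] by (auto simp: u_def v_def length_query_diff)
  have B: "measure_pmf.prob (random_seed m) B \<le> 1/4"
    using prob_hashes_agree[OF len] by (cases "u = v") (auto simp: B_def)
  have w: "0 < ?w" by (rule history_weight_pos)
  \<comment> \<open>Off the collision event \<open>B\<close> the weight halves; on \<open>B\<close>
    it at most doubles, as 1/2 + 3/2 = 2.\<close>
  have pt: "history_weight N Z (walk_step N X Y \<rho> as) \<le> ?w / 2 + 3/2 * ?w * indicator B \<rho>" for \<rho>
  proof (cases "correct_len N Z as = length as")
    case True
    have step: "walk_step N X Y \<rho> as = hashes_agree \<rho> (query_diff N X as) (query_diff N Y as) # as"
      using True claimed_diffs_eq_iff[OF assms(1)] by (simp add: walk_step_def hashes_agree_refl)
    show ?thesis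
    proof (cases "\<rho> \<in> B")
      case True
      then show ?thesis unfolding step using history_weight_Cons_le[of N Z _ as] by simp
    next
      case False
      then have "hashes_agree \<rho> (query_diff N X as) (query_diff N Y as) = true_answer N Z as"
        using True by (auto simp: B_def u_def v_def hashes_agree_refl simp flip: query_diff_eq_iff)
      then show ?thesis
        unfolding step using history_weight_Cons_correct[OF True] False by simp
    qed
  next
    case False
    then have "u \<noteq> v" using claimed_diffs_eq_iff[OF assms(1)] by (simp add: u_def v_def)
    show ?thesis
    proof (cases "\<rho> \<in> B")
      case True
      then show ?thesis
        using False history_weight_Cons_le[of N Z _ as] by (simp add: B_def u_def v_def walk_step_def)
    next
      case nB: False
      then show ?thesis
        using False \<open>u \<noteq> v\<close> history_weight_tl[OF False] by (simp add: B_def u_def v_def walk_step_def)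
    qed
  qed
  have "(\<integral>\<^sup>+\<rho>. ennreal (history_weight N Z (walk_step N X Y \<rho> as)) \<partial>random_seed m)
      \<le> (\<integral>\<^sup>+\<rho>. ennreal (?w / 2) + ennreal (3/2 * ?w) * indicator B \<rho> \<partial>random_seed m)"
  proof (rule nn_integral_mono)
    fix \<rho>
    have "ennreal (history_weight N Z (walk_step N X Y \<rho> as))
        \<le> ennreal (?w / 2 + 3/2 * ?w * indicator B \<rho>)"
      using pt by (rule ennreal_leI)
    also have "\<dots> = ennreal (?w / 2) + ennreal (3/2 * ?w) * indicator B \<rho>"
      using w by (simp add: indicator_def flip: ennreal_plus)
    finally show "ennreal (history_weight N Z (walk_step N X Y \<rho> as))
        \<le> ennreal (?w / 2) + ennreal (3/2 * ?w) * indicator B \<rho>" .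
  qed
  also have "\<dots> = ennreal (?w / 2 + 3/2 * ?w * measure_pmf.prob (random_seed m) B)"
    using w by (simp add: nn_integral_add nn_integral_cmult_indicator measure_pmf.emeasure_eq_measure
        flip: ennreal_mult ennreal_plus)
  also have "\<dots> \<le> ennreal (7/8 * ?w)"
    using w B by (intro ennreal_leI) (simp add: field_simps)
  finally show ?thesis .
qed

text \<open>Induction on the first step, each contributing 7/8. The bound on \<open>m\<close> lets a
  seed cover the strings of every history reachable in the remaining steps.\<close>

lemma prob_walk_fails:
  assumes "sound N Z as" "(length as + T) * k \<le> m"
  shows "emeasure (replicate_pmf T (random_seed m))
      {\<rho>s. correct_len N Z (fold (walk_step N X Y) \<rho>s as) < N}
    \<le> ennreal (2 ^ N * (7/8) ^ T * history_weight N Z as)"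
  using assms
proof (induction T arbitrary: as)
  case 0
  show ?case
  proof (cases "correct_len N Z as < N")
    case True
    then show ?thesis using history_weight_ge[OF True] by simp
  qed (simp add: emeasure_pmf_single)
next
  case (Suc T)
  let ?fail = "\<lambda>as. {\<rho>s. correct_len N Z (fold (walk_step N X Y) \<rho>s as) < N}"
  have rec: "replicate_pmf (Suc T) (random_seed m) =
      random_seed m \<bind> (\<lambda>\<rho>. map_pmf ((#) \<rho>) (replicate_pmf T (random_seed m)))"
    by (simp add: map_pmf_def)
  have "emeasure (replicate_pmf (Suc T) (random_seed m)) (?fail as) =
      (\<integral>\<^sup>+\<rho>. emeasure (replicate_pmf T (random_seed m)) (?fail (walk_step N X Y \<rho> as)) \<partial>random_seed m)"
    unfolding rec by (simp add: emeasure_bind_pmf vimage_def)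
  also have "\<dots> \<le> (\<integral>\<^sup>+\<rho>. ennreal (2 ^ N * (7/8) ^ T) * ennreal (history_weight N Z (walk_step N X Y \<rho> as))
      \<partial>random_seed m)"
  proof (rule nn_integral_mono)
    fix \<rho>
    have "length (walk_step N X Y \<rho> as) \<le> Suc (length as)"
      by (auto simp: walk_step_def)
    then have "(length (walk_step N X Y \<rho> as) + T) * k \<le> (length as + Suc T) * k"
      by (intro mult_le_mono1) simp
    then have "(length (walk_step N X Y \<rho> as) + T) * k \<le> m"
      using Suc.prems(2) by (rule le_trans)
    from Suc.IH[OF sound_walk_step[OF Suc.prems(1)] this]
    show "emeasure (replicate_pmf T (random_seed m)) (?fail (walk_step N X Y \<rho> as))
        \<le> ennreal (2 ^ N * (7/8) ^ T) * ennreal (history_weight N Z (walk_step N X Y \<rho> as))"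
      using history_weight_pos[of N Z "walk_step N X Y \<rho> as"] by (simp add: ennreal_mult)
  qed
  also have "\<dots> = ennreal (2 ^ N * (7/8) ^ T) *
      (\<integral>\<^sup>+\<rho>. ennreal (history_weight N Z (walk_step N X Y \<rho> as)) \<partial>random_seed m)"
    by (simp add: nn_integral_cmult)
  also have "\<dots> \<le> ennreal (2 ^ N * (7/8) ^ T) * ennreal (7/8 * history_weight N Z as)"
  proof (intro mult_left_mono expected_weight_walk_step Suc.prems)
    have "Suc (length as) * k \<le> (length as + Suc T) * k"
      by (intro mult_le_mono1) simp
    then show "Suc (length as) * k \<le> m"
      using Suc.prems(2) by (rule le_trans)
  qed simp
  also have "\<dots> = ennreal (2 ^ N * (7/8) ^ Suc T * history_weight N Z as)"
    using history_weight_pos[of N Z as] by (simp flip: ennreal_mult add: mult_ac)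
  finally show ?case .
qed

end

section \<open>The protocol\<close>

text \<open>Branching on both parities of Alice passes them to Bob, whose message function sees only
  his own data. His verdict tells both parties how to go on.\<close>

definition hash_test ::
  "bits \<times> bits \<Rightarrow> ('a \<Rightarrow> bits) \<Rightarrow> ('b \<Rightarrow> bits) \<Rightarrow> (bool \<Rightarrow> ('a, 'b) prot_tree) \<Rightarrow> ('a, 'b) prot_tree" where
  "hash_test \<rho> f g cont =
     (let reply = \<lambda>h1 h2. Bob (\<lambda>b. parity_hash (fst \<rho>) (g b) = h1 \<and> parity_hash (snd \<rho>) (g b) = h2)
            (cont False) (cont True);
          second = \<lambda>h1. Alice (\<lambda>a. parity_hash (snd \<rho>) (f a)) (reply h1 False) (reply h1 True)
      in Alice (\<lambda>a. parity_hash (fst \<rho>) (f a)) (second False) (second True))"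

definition hash_messages :: "bits \<times> bits \<Rightarrow> bits \<Rightarrow> bits \<Rightarrow> bits" where
  "hash_messages \<rho> u v = [parity_hash (fst \<rho>) u, parity_hash (snd \<rho>) u, hashes_agree \<rho> u v]"

lemma length_hash_messages: "length (hash_messages \<rho> u v) = 3"
  by (simp add: hash_messages_def)

lemma run_hash_test:
  "run (hash_test \<rho> f g cont) a b =
     hash_messages \<rho> (f a) (g b) @ run (cont (hashes_agree \<rho> (f a) (g b))) a b"
  by (cases "parity_hash (fst \<rho>) (f a)"; cases "parity_hash (snd \<rho>) (f a)";
      cases "parity_hash (fst \<rho>) (g b)"; cases "parity_hash (snd \<rho>) (g b)")
    (simp_all add: hash_test_def hash_messages_def hashes_agree_def)

fun send_zeros :: "nat \<Rightarrow> ('a, 'b) prot_tree" where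
  "send_zeros 0 = Halt"
| "send_zeros (Suc n) = Alice (\<lambda>_. False) (send_zeros n) Halt"

lemma run_send_zeros: "run (send_zeros n) a b = replicate n False"
  by (induction n) auto

text \<open>The elected index is announced in unary at the end, so that the outputs can be read off the
  transcript without replaying the walk.\<close>

fun walk_tree ::
  "nat \<Rightarrow> (bits \<times> bits) list \<Rightarrow> bool list \<Rightarrow> (bits list \<times> bits, bits list \<times> bits) prot_tree" where
  "walk_tree N [] as = Alice (\<lambda>_. True) Halt (send_zeros (fst (vote N as)))"
| "walk_tree N (\<rho> # \<rho>s) as =
     hash_test \<rho> (\<lambda>a. claimed_diffs N (fst a) as) (\<lambda>b. claimed_diffs N (fst b) as)
       (\<lambda>ok. if ok then
           hash_test \<rho> (\<lambda>a. query_diff N (fst a) as) (\<lambda>b. query_diff N (fst b) as)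
             (\<lambda>ans. walk_tree N \<rho>s (ans # as))
         else walk_tree N \<rho>s (tl as))"

text \<open>Counts the zeros after the last \<open>True\<close>, the separator sent at the end of
  the walk.\<close>

definition announced :: "bits \<Rightarrow> nat" where
  "announced t = length (takeWhile Not (rev t))"

lemma announced_unary: "announced (t @ True # replicate n False) = n"
  by (simp add: announced_def takeWhile_append takeWhile_replicate)

lemma run_walk_tree:
  "\<exists>t. length t \<le> 6 * length \<rho>s \<and> run (walk_tree N \<rho>s as) (X, rA) (Y, rB) =
     t @ True # replicate (fst (vote N (fold (walk_step N X Y) \<rho>s as))) False"
proof (induction \<rho>s arbitrary: as)
  case Nil
  then show ?case by (simp add: run_send_zeros)
next
  case (Cons \<rho> \<rho>s)
  obtain t where t: "length t \<le> 6 * length \<rho>s"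
    "run (walk_tree N \<rho>s (walk_step N X Y \<rho> as)) (X, rA) (Y, rB) =
     t @ True # replicate (fst (vote N (fold (walk_step N X Y) \<rho>s (walk_step N X Y \<rho> as)))) False"
    using Cons.IH by blast
  define c where "c = hash_messages \<rho> (claimed_diffs N X as) (claimed_diffs N Y as)"
  define q where "q = hash_messages \<rho> (query_diff N X as) (query_diff N Y as)"
  \<comment> \<open>One step of the walk costs one or two tests of three bits each.\<close>
  define p where
    "p = (if hashes_agree \<rho> (claimed_diffs N X as) (claimed_diffs N Y as) then c @ q else c)"
  have "length p \<le> 6"
    by (simp add: p_def c_def q_def length_hash_messages)
  moreover have "run (walk_tree N (\<rho> # \<rho>s) as) (X, rA) (Y, rB) =
      p @ run (walk_tree N \<rho>s (walk_step N X Y \<rho> as)) (X, rA) (Y, rB)"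
    by (simp add: run_hash_test walk_step_def p_def c_def q_def)
  ultimately show ?case
    using t by (intro exI[of _ "p @ t"]) (simp del: walk_tree.simps)
qed

text \<open>Public coins are single bit strings, so the list of seeds is encoded through its number, in
  unary.\<close>

definition majority_protocol :: "nat \<Rightarrow> nat \<Rightarrow> nat \<Rightarrow> (bits list, bits list) protocol" where
  "majority_protocol N k T =
     \<lparr> public_coins = map_pmf (\<lambda>\<rho>s. replicate (to_nat \<rho>s) True) (replicate_pmf T (random_seed (T * k))),
       alice_coins = return_pmf [],
       bob_coins = return_pmf [],
       tree = (\<lambda>r. walk_tree N (from_nat (length r)) []) \<rparr>"

lemma cost_majority_protocol:
  assumes "0 < N"
  shows "cost (GapMaj_xor N k \<epsilon>) (majority_protocol N k T) \<le> enat (6 * T + N)"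
  unfolding cost_def
proof (intro SUP_least, clarify)
  fix X Y r rA rB
  assume "(r, rA, rB) \<in> set_pmf (coins (majority_protocol N k T))"
  then obtain \<rho>s where \<rho>s: "\<rho>s \<in> set_pmf (replicate_pmf T (random_seed (T * k)))"
    "r = replicate (to_nat \<rho>s) True"
    by (auto simp: coins_def majority_protocol_def)
  then have "length \<rho>s = T" by (simp add: set_replicate_pmf)
  \<comment> \<open>Separator and zeros together take at most \<open>N\<close> bits.\<close>
  moreover have "fst (vote N (fold (walk_step N X Y) \<rho>s [])) < N"
    using assms by (rule fst_vote_less)
  ultimately have "length (transcript (majority_protocol N k T) r rA rB X Y) \<le> 6 * T + N"
    using run_walk_tree[of \<rho>s N "[]" X rA Y rB]
    by (auto simp: transcript_def majority_protocol_def \<rho>s)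
  then show "enat (length (transcript (majority_protocol N k T) r rA rB X Y)) \<le> enat (6 * T + N)"
    by simp
qed

text \<open>Outputs must have length \<open>k\<close> even on meaningless transcripts or inputs;
  strings of length \<open>k\<close> are unchanged.\<close>

definition pad :: "nat \<Rightarrow> bits \<Rightarrow> bits" where
  "pad k w = take k (w @ replicate k False)"

lemma xor_computes_majority_protocol:
  assumes N: "0 < N" and "\<epsilon> < 1/2" and err: "2 ^ N * (7/8) ^ T \<le> err"
  shows "xor_computes (majority_protocol N k T) (GapMaj_xor N k \<epsilon>) err"
proof -
  let ?O = "\<lambda>t (r :: bits) (r' :: bits) X. pad k (X ! announced t)"
  let ?\<pi> = "majority_protocol N k T"
  let ?win = "\<lambda>X Y z. {(r, rA, rB).
    ?O (transcript ?\<pi> r rA rB X Y) r rA X \<oplus>\<^sub>b ?O (transcript ?\<pi> r rA rB X Y) r rB Y = z}"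
  have win_prob: "1 - err \<le> measure_pmf.prob (coins ?\<pi>) (?win X Y z)"
    if "X \<in> alice_inputs (GapMaj_xor N k \<epsilon>)" "Y \<in> bob_inputs (GapMaj_xor N k \<epsilon>)"
      and ans: "answer (GapMaj_xor N k \<epsilon>) X Y z" for X Y z
  proof -
    from that interpret gap_maj_inputs N k X Y
      using N by unfold_locales (auto simp: GapMaj_xor_def)
    have "(1 - \<epsilon>) * real N \<le> real (card {i. i < N \<and> Z i = z})"
      using ans by (simp add: GapMaj_xor_def)
    moreover have "1/2 * real N < (1 - \<epsilon>) * real N"
      using assms(2) N by (intro mult_strict_right_mono) auto
    ultimately have maj: "N < 2 * card {i. i < N \<and> Z i = z}"
      by linarith
    let ?R = "replicate_pmf T (random_seed (T * k))"
    let ?fail = "{\<rho>s. correct_len N Z (fold (walk_step N X Y) \<rho>s []) < N}"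
    have win: "(replicate (to_nat \<rho>s) True, rA, rB) \<in> ?win X Y z" if "\<rho>s \<notin> ?fail" for \<rho>s rA rB
    proof -
      let ?c = "fst (vote N (fold (walk_step N X Y) \<rho>s []))"
      have "announced (transcript ?\<pi> (replicate (to_nat \<rho>s) True) rA rB X Y) = ?c"
        using run_walk_tree[of \<rho>s N "[]" X rA Y rB]
        by (auto simp: transcript_def majority_protocol_def announced_unary)
      moreover have "?c < N" using N by (rule fst_vote_less)
      moreover have "Z ?c = z"
        using vote_finds_majority[OF _ maj] that by simp
      ultimately show ?thesis by (simp add: pad_def length_nth)
    qed
    have coins: "coins ?\<pi> = map_pmf (\<lambda>\<rho>s. (replicate (to_nat \<rho>s) True, [], [])) ?R"
      by (simp add: coins_def majority_protocol_def pair_return_pmf1 pair_return_pmf2 pair_map_pmf1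
          pmf.map_comp comp_def)
    have "emeasure ?R ?fail \<le> ennreal (2 ^ N * (7/8) ^ T)"
      using prob_walk_fails[of "[]" T "T * k"] by (simp add: history_weight_def)
    then have fail: "measure_pmf.prob ?R ?fail \<le> err"
      using err by (simp add: measure_pmf.emeasure_eq_measure)
    have "1 - err \<le> measure_pmf.prob ?R (- ?fail)"
      using fail measure_pmf.prob_compl[of ?fail ?R] by (simp add: Compl_eq_Diff_UNIV)
    also have "\<dots> \<le> measure_pmf.prob (coins ?\<pi>) (?win X Y z)"
      unfolding coins measure_map_pmf using win by (intro measure_pmf.finite_measure_mono) auto
    finally show "1 - err \<le> measure_pmf.prob (coins ?\<pi>) (?win X Y z)" .
  qed
  have "?O t r r' X \<in> bitstrings (out_len (GapMaj_xor N k \<epsilon>))" for t r r' X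
    by (simp add: bitstrings_def GapMaj_xor_def pad_def)
  then show ?thesis
    unfolding xor_computes_def using win_prob
    by (intro exI[of _ ?O] conjI allI ballI impI) blast+
qed

theorem mainTheorem6:
  "\<exists>C :: real. C > 0 \<and>
     (\<forall>(\<epsilon>' :: real) (\<epsilon> :: real) (N :: nat) (k :: nat).
        0 < \<epsilon>' \<and> \<epsilon>' < \<epsilon> \<and> \<epsilon> < 1 / 2 \<and> N \<ge> 1 \<and> k \<ge> 1 \<longrightarrow>
        ereal_of_enat (R_xor \<epsilon>' (GapMaj_xor N k \<epsilon>))
          \<le> ereal (C * (real N + log 2 (1 / \<epsilon>'))))"
proof (intro exI[of _ 73] conjI allI impI, simp, elim conjE)
  fix \<epsilon>' \<epsilon> :: real and N k :: nat
  assume \<epsilon>: "0 < \<epsilon>'" "\<epsilon>' < \<epsilon>" "\<epsilon> < 1/2" and "1 \<le> N" "1 \<le> k"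
  define l where "l = log 2 (1 / \<epsilon>')"
  define L where "L = nat \<lceil>l\<rceil>"
  have l: "0 < l" "l \<le> real L" "real L \<le> l + 1"
    using \<epsilon> by (auto simp: l_def L_def)
  \<comment> \<open>Six steps suffice to halve the failure bound, since \<open>(7/8) ^ 6\<close> is
    below 1/2: \<open>N\<close> halvings cancel \<open>2 ^ N\<close>, and \<open>L\<close> more
    reach the error.\<close>
  have "(7/8 :: real) ^ (6 * (N + L)) = ((7/8) ^ 6) ^ (N + L)"
    by (rule power_mult)
  also have "\<dots> \<le> (1/2) ^ (N + L)"
    by (intro power_mono) (simp_all add: eval_nat_numeral)
  finally have "2 ^ N * (7/8 :: real) ^ (6 * (N + L)) \<le> 2 ^ N * (1/2) ^ (N + L)"
    by simp
  also have "\<dots> = (1/2) ^ L"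
    by (simp add: power_add power_one_over)
  also have "\<dots> = 2 powr (- real L)"
    by (simp add: powr_minus powr_realpow power_one_over divide_simps)
  also have "\<dots> \<le> 2 powr (- l)"
    using l by simp
  also have "\<dots> = \<epsilon>'"
    using \<epsilon> by (simp add: l_def powr_minus)
  finally have "xor_computes (majority_protocol N k (6 * (N + L))) (GapMaj_xor N k \<epsilon>) \<epsilon>'"
    using \<epsilon> \<open>1 \<le> N\<close> by (intro xor_computes_majority_protocol) auto
  then have "R_xor \<epsilon>' (GapMaj_xor N k \<epsilon>) \<le> cost (GapMaj_xor N k \<epsilon>) (majority_protocol N k (6 * (N + L)))"
    unfolding R_xor_def by (intro INF_lower) simp
  also have "\<dots> \<le> enat (6 * (6 * (N + L)) + N)"
    using \<open>1 \<le> N\<close> by (intro cost_majority_protocol) simp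
  finally have "ereal_of_enat (R_xor \<epsilon>' (GapMaj_xor N k \<epsilon>)) \<le> ereal_of_enat (enat (37 * N + 36 * L))"
    by (simp only: ereal_of_enat_le_iff) simp
  \<comment> \<open>Rounding up \<open>l\<close> costs at most 36, absorbed by 36 * \<open>N\<close>
    as \<open>N\<close> is positive; 73 = 37 + 36.\<close>
  also have "\<dots> \<le> ereal (73 * (real N + l))"
    using l \<open>1 \<le> N\<close> by simp
  finally show "ereal_of_enat (R_xor \<epsilon>' (GapMaj_xor N k \<epsilon>)) \<le> ereal (73 * (real N + log 2 (1 / \<epsilon>')))"
    by (simp add: l_def)
qed

end
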